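(* Let $r\ge0$ be a real number, let $l=\{a_i;\ i=1,2,3,\dots\}$ be a bounded sequence of real numbers, i.e. there is a number $m$ such that $|a_i|<m$ for all $i\in\mathbb{N}$, and let $a\in\mathbb{R}$. If $a=\mathrm{stat}\text{-}r\text{-}\lim l$, then $a=r\text{-}\lim\mu(l)$, where $\mu(l)=\{\mu_n=\frac1n\sum_{i=1}^n a_i;\ n=1,2,3,\dots\}$.
   Context: $\mathbb{N}=\{1,2,3,\dots\}$. For $K\subseteq\mathbb{N}$ put $K_n=\{k\in K: k\le n\}$; the asymptotic density of $K$ is $d(K)=\lim_{n\to\infty}\frac1n|K_n|$ whenever the limit exists. For a real $r\ge0$: $a=\mathrm{stat}\text{-}r\text{-}\lim l$ means that for every $\varepsilon>0$ the set $\{i\in\mathbb{N}: |a_i-a|\ge r+\varepsilon\}$ has density $0$; and $a=r\text{-}\lim\{b_n\}$ means that for every $\varepsilon>0$ the inequality $|b_n-a|<r+\varepsilon$ holds for all sufficiently large $n$. *)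

theory Defs
  imports Complex_Main
begin

text \<open>
  The natural numbers start at 1 here. A sequence is a function of type
  \<open>nat \<Rightarrow> real\<close> of which only the values at indices \<open>i \<ge> 1\<close> matter, and only the
  positive elements of a set of indices are counted.
\<close>

definition initial_part :: "nat set \<Rightarrow> nat \<Rightarrow> nat set" where
  "initial_part K n = {k \<in> K. 1 \<le> k \<and> k \<le> n}"

text \<open>The density is partial, so it is a relation: the limit exists and equals \<open>d\<close>.\<close>

definition has_density :: "nat set \<Rightarrow> real \<Rightarrow> bool" where
  "has_density K d \<longleftrightarrow> (\<lambda>n. 1 / real n * real (card (initial_part K n))) \<longlonglongrightarrow> d"

text \<open>Neither kind of fuzzy limit is unique, so both are relations as well.\<close>

definition stat_r_lim :: "real \<Rightarrow> (nat \<Rightarrow> real) \<Rightarrow> real \<Rightarrow> bool" where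
  "stat_r_lim r l a \<longleftrightarrow> (\<forall>\<epsilon>>0. has_density {i. 1 \<le> i \<and> \<bar>l i - a\<bar> \<ge> r + \<epsilon>} 0)"

definition r_lim :: "real \<Rightarrow> (nat \<Rightarrow> real) \<Rightarrow> real \<Rightarrow> bool" where
  "r_lim r b a \<longleftrightarrow> (\<forall>\<epsilon>>0. \<forall>\<^sub>F n in sequentially. \<bar>b n - a\<bar> < r + \<epsilon>)"

definition partial_mean :: "(nat \<Rightarrow> real) \<Rightarrow> nat \<Rightarrow> real" where
  "partial_mean l n = 1 / real n * (\<Sum>i=1..n. l i)"

end

theory Submission
  imports Defs
begin

text \<open>
  The deviation of the mean \<open>\<mu>\<^sub>n\<close> from \<open>a\<close> is at most the mean of the deviations
  \<open>\<bar>l i - a\<bar>\<close>. Call an index exceptional if its deviation is at least a threshold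
  \<open>c\<close>. The other indices contribute at most \<open>c\<close> to this mean; by boundedness the
  exceptional ones contribute at most a constant times their relative frequency up to \<open>n\<close>.
  This is \<open>partial_mean_deviation_le\<close>. For \<open>c = r + \<epsilon> / 2\<close> the frequency tends to \<open>0\<close>
  by statistical convergence, so the second contribution is eventually below \<open>\<epsilon> / 2\<close>.
\<close>

lemma partial_mean_minus:
  assumes "n \<ge> 1"
  shows "partial_mean l n - a = 1 / real n * (\<Sum>i=1..n. l i - a)"
  using assms by (simp add: partial_mean_def sum_subtractf field_simps)

text \<open>
  Termwise, \<open>\<bar>l i - a\<bar>\<close> is at most \<open>c\<close> plus \<open>M\<close> times the indicator of the exceptional
  set; averaging turns the indicator into the relative frequency of that set.
\<close>

lemma partial_mean_deviation_le:
  fixes l :: "nat \<Rightarrow> real"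
  assumes n: "n \<ge> 1" and c: "c \<ge> 0" and M: "\<And>i. i \<ge> 1 \<Longrightarrow> \<bar>l i - a\<bar> \<le> M"
  defines "K \<equiv> {i. 1 \<le> i \<and> \<bar>l i - a\<bar> \<ge> c}"
  shows "\<bar>partial_mean l n - a\<bar> \<le> c + M * (1 / real n * real (card (initial_part K n)))"
proof -
  have termwise: "\<bar>l i - a\<bar> \<le> c + (if i \<in> K then M else 0)" if "i \<in> {1..n}" for i
    using that c M[of i] by (auto simp: K_def)
  have exceptional: "{1..n} \<inter> K = initial_part K n"
    by (auto simp: initial_part_def)
  have "\<bar>\<Sum>i=1..n. l i - a\<bar> \<le> (\<Sum>i=1..n. \<bar>l i - a\<bar>)"
    by (rule sum_abs)
  also have "\<dots> \<le> (\<Sum>i=1..n. c + (if i \<in> K then M else 0))"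
    by (rule sum_mono) (rule termwise)
  also have "\<dots> = real n * c + (\<Sum>i\<in>{1..n} \<inter> K. M)"
    by (simp add: sum.distrib flip: sum.inter_restrict)
  also have "\<dots> = real n * c + M * real (card (initial_part K n))"
    unfolding exceptional by simp
  finally have "\<bar>\<Sum>i=1..n. l i - a\<bar> \<le> real n * c + M * real (card (initial_part K n))" .
  then show ?thesis
    using n by (simp add: partial_mean_minus abs_mult field_simps)
qed

theorem theorem4p1:
  fixes r a :: real and l :: "nat \<Rightarrow> real"
  assumes "r \<ge> 0"
    and "\<exists>m. \<forall>i\<ge>1. \<bar>l i\<bar> < m"
    and "stat_r_lim r l a"
  shows "r_lim r (partial_mean l) a"
  unfolding r_lim_def
proof (intro allI impI)
  fix \<epsilon> :: real
  assume \<epsilon>: "\<epsilon> > 0"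
  obtain m where m: "\<And>i. i \<ge> 1 \<Longrightarrow> \<bar>l i\<bar> < m"
    using assms(2) by blast
  define M where "M = m + \<bar>a\<bar>"
  have M: "\<bar>l i - a\<bar> \<le> M" if "i \<ge> 1" for i
    using m[OF that] by (simp add: M_def)
  define K where "K = {i. 1 \<le> i \<and> \<bar>l i - a\<bar> \<ge> r + \<epsilon> / 2}"
  define freq where "freq n = 1 / real n * real (card (initial_part K n))" for n
  have "freq \<longlonglongrightarrow> 0"
    using assms(3) \<epsilon> half_gt_zero[OF \<epsilon>]
    unfolding stat_r_lim_def has_density_def K_def freq_def by blast
  then have "(\<lambda>n. M * freq n) \<longlonglongrightarrow> 0"
    by (rule tendsto_mult_right_zero)
  then have "\<forall>\<^sub>F n in sequentially. M * freq n < \<epsilon> / 2"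
    by (rule order_tendstoD(2)) (use \<epsilon> in simp)
  \<comment> \<open>At \<open>n = 0\<close> the division by zero makes the mean \<open>0\<close>, and the estimate may fail.\<close>
  then show "\<forall>\<^sub>F n in sequentially. \<bar>partial_mean l n - a\<bar> < r + \<epsilon>"
    using eventually_ge_at_top[of 1]
  proof eventually_elim
    case (elim n)
    have "\<bar>partial_mean l n - a\<bar> \<le> (r + \<epsilon> / 2) + M * freq n"
      unfolding freq_def K_def
      by (rule partial_mean_deviation_le) (use elim(2) assms(1) \<epsilon> M in auto)
    then show ?case
      using elim(1) by simp
  qed
qed

end
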